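(* Let $f$ be a moment determinate measurable function with compact support $[0,1]^2$ such that $\int_{[0,1]^2}f=1$, and let $f\in C^2([0,1]^2)$. Then $app(f)$ converges uniformly to $f$ on $[0,1]^2$ as $m,n\to\infty$, and $$\|app(f)-f\|\le\frac{2\|f_{10}\|+\frac12\|f_{20}\|}{m+2}+\frac{2\|f_{01}\|+\frac12\|f_{02}\|}{n+2}+\frac{\frac12\|f_{11}\|}{\sqrt{(m+2)(n+2)}}+o\Big(\frac1m\Big)+o\Big(\frac1n\Big)+o\Big(\frac1{\sqrt{mn}}\Big).$$ In particular, by choosing $m=n$, we have, as $n\to\infty$, $$\|app(f)-f\|\le\frac{C}{n+2}+o\Big(\frac1n\Big),$$ where $\|\cdot\|$ is the sup-norm and $C=2\big(\|f_{10}\|+\|f_{01}\|\big)+\frac12\big(\|f_{20}\|+\|f_{11}\|+\|f_{02}\|\big)$.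
   Context: A function is moment determinate if it is uniquely determined by its moments. The moments are $\gamma_{\alpha_1,\alpha_2}(f)=\int_{\mathbb{R}^2}x_1^{\alpha_1}x_2^{\alpha_2}f(x)\,dx$, $\alpha_1,\alpha_2\in\mathbb{N}_0$. The functions $f_{10},f_{01},f_{20},f_{11},f_{02}$ denote the partial derivatives of $f$ up to second order: $f_{ij}=\partial^{i+j}f/\partial x_1^i\partial x_2^j$. $\|\cdot\|$ is the sup-norm on $[0,1]^2$. For $m,n\in\mathbb{N}$ and $x=(x_1,x_2)\in[0,1]^2$, with $[a]$ the integer part of $a$, the approximation $app(f)$ (depending on $m,n$) is $$app(f)(x)=C_{m,n}(x)\sum_{\alpha_1=0}^{m-[mx_1]}\ \sum_{\alpha_2=0}^{n-[nx_2]}\frac{(-1)^{\alpha_1+\alpha_2}\,\gamma_{\alpha_1+[mx_1],\,\alpha_2+[nx_2]}(f)}{\alpha_1!\,\alpha_2!\,(m-[mx_1]-\alpha_1)!\,(n-[nx_2]-\alpha_2)!},$$ $$C_{m,n}(x)=\frac{\Gamma(m+2)\,\Gamma(n+2)}{\Gamma([mx_1]+1)\,\Gamma([nx_2]+1)}.$$ *)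

theory Defs
  imports "HOL-Analysis.Analysis" "HOL-Library.Landau_Symbols"
begin

definition unit_square :: "(real \<times> real) set" where
  "unit_square = {0..1} \<times> {0..1}"

definition closed_support :: "(real \<times> real \<Rightarrow> real) \<Rightarrow> (real \<times> real) set" where
  "closed_support f = closure {x. f x \<noteq> 0}"

definition moment :: "nat \<Rightarrow> nat \<Rightarrow> (real \<times> real \<Rightarrow> real) \<Rightarrow> real" where
  "moment a b f = (LINT x|lebesgue. fst x ^ a * snd x ^ b * f x)"

text \<open>
  Uniqueness is understood up to null sets, and the competitors range over the compactly
  supported functions all of whose moments exist. Without a restriction on the support the notion
  would be empty for real-valued functions, as there are nonzero Schwartz functions
  on the plane all of whose moments vanish.
\<close>
definition moment_determinate :: "(real \<times> real \<Rightarrow> real) \<Rightarrow> bool" where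
  "moment_determinate f \<longleftrightarrow>
     (\<forall>g. compact (closed_support g) \<longrightarrow>
          (\<forall>a b. integrable lebesgue (\<lambda>x. fst x ^ a * snd x ^ b * g x)) \<longrightarrow>
          (\<forall>a b. moment a b g = moment a b f) \<longrightarrow>
          (AE x in lebesgue. g x = f x))"

text \<open>
  Partial derivatives of a function on the closed unit square: derivatives are taken within
  \<open>{0..1}\<close>, hence are one-sided on the boundary. This matters because a function
  supported in the square may jump to zero across its boundary. The values outside the square are
  irrelevant.
\<close>
definition pd1 :: "(real \<times> real \<Rightarrow> real) \<Rightarrow> real \<times> real \<Rightarrow> real" where
  "pd1 f x = vector_derivative (\<lambda>t. f (t, snd x)) (at (fst x) within {0..1})"

definition pd2 :: "(real \<times> real \<Rightarrow> real) \<Rightarrow> real \<times> real \<Rightarrow> real" where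
  "pd2 f x = vector_derivative (\<lambda>t. f (fst x, t)) (at (snd x) within {0..1})"

definition pd :: "nat \<Rightarrow> nat \<Rightarrow> (real \<times> real \<Rightarrow> real) \<Rightarrow> real \<times> real \<Rightarrow> real" where
  "pd i j f = (pd1 ^^ i) ((pd2 ^^ j) f)"

primrec Ck_square :: "nat \<Rightarrow> (real \<times> real \<Rightarrow> real) \<Rightarrow> bool" where
  "Ck_square 0 f \<longleftrightarrow> continuous_on unit_square f"
| "Ck_square (Suc k) f \<longleftrightarrow>
     continuous_on unit_square f \<and>
     (\<forall>x\<in>unit_square.
        (\<lambda>t. f (t, snd x)) differentiable (at (fst x) within {0..1}) \<and>
        (\<lambda>t. f (fst x, t)) differentiable (at (snd x) within {0..1})) \<and>
     Ck_square k (pd1 f) \<and> Ck_square k (pd2 f)"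

text \<open>The supremum is taken in the reals, so this is meaningful for functions bounded on the square.\<close>
definition supnorm :: "(real \<times> real \<Rightarrow> real) \<Rightarrow> real" where
  "supnorm g = (SUP x\<in>unit_square. \<bar>g x\<bar>)"

definition app_coeff :: "nat \<Rightarrow> nat \<Rightarrow> real \<times> real \<Rightarrow> real" where
  "app_coeff m n x =
     Gamma (real m + 2) * Gamma (real n + 2) /
     (Gamma (of_int \<lfloor>real m * fst x\<rfloor> + 1) * Gamma (of_int \<lfloor>real n * snd x\<rfloor> + 1))"

text \<open>
  On the unit square \<open>k \<le> m\<close> and \<open>l \<le> n\<close>, so neither \<^const>\<open>nat\<close> nor the
  natural-number subtractions truncate.
\<close>
definition app :: "nat \<Rightarrow> nat \<Rightarrow> (real \<times> real \<Rightarrow> real) \<Rightarrow> real \<times> real \<Rightarrow> real" where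
  "app m n f x =
     (let k = nat \<lfloor>real m * fst x\<rfloor>; l = nat \<lfloor>real n * snd x\<rfloor> in
      app_coeff m n x *
      (\<Sum>a = 0..m - k. \<Sum>b = 0..n - l.
         (- 1) ^ (a + b) * moment (a + k) (b + l) f /
         (fact a * fact b * fact (m - k - a) * fact (n - l - b))))"

end

theory Submission
  imports Defs
begin

text \<open>
  With \<open>k = \<lfloor>m x\<^sub>1\<rfloor>\<close> and \<open>l = \<lfloor>n x\<^sub>2\<rfloor>\<close>, the alternating sum of moments in \<^const>\<open>app\<close> is the
  binomial expansion of \<open>u\<^sub>1\<^sup>k (1 - u\<^sub>1)\<^bsup>m - k\<^esup> u\<^sub>2\<^sup>l (1 - u\<^sub>2)\<^bsup>n - l\<^esup>\<close> integrated against \<open>f\<close>, and the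
  Gamma factors normalise this weight to a probability density. Hence the approximation at \<open>x\<close>
  is the expectation of \<open>f (U, V)\<close> for independent \<open>U\<close> and \<open>V\<close> with the distributions
  Beta\<open>(k + 1, m - k + 1)\<close> and Beta\<open>(l + 1, n - l + 1)\<close> (lemma \<open>app_eq_beta_average\<close>).

  The mean \<open>(k + 1) / (m + 2)\<close> of \<open>U\<close> lies within \<open>2 / (m + 2)\<close> of \<open>x\<^sub>1\<close>, so replacing \<open>x\<close> by the
  point of means costs the first-derivative terms of the bound, by the mean value theorem.
  Around the point of means the linear part of \<open>f\<close> averages to zero and the second-order
  remainder is controlled by the variances, which are at most \<open>1 / (4 (m + 2))\<close> and
  \<open>1 / (4 (n + 2))\<close> (lemma \<open>beta_average_error\<close>). This gives the second-derivative terms, the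
  mixed one coming from the geometric mean of the two variances.

  Both steps are exact inequalities for all \<open>m\<close> and \<open>n\<close>, so every asymptotic remainder in the
  theorem can be taken to be zero (lemma \<open>app_error\<close>), and uniform convergence holds because the
  bound tends to zero.
\<close>

section \<open>Functions of class C2 on the square\<close>

lemma unit_square_eq_cbox: "unit_square = cbox (0, 0) (1, 1)"
  by (simp add: unit_square_def cbox_Pair_eq)

lemma mem_unit_square_iff:
  "x \<in> unit_square \<longleftrightarrow> fst x \<in> {0..1} \<and> snd x \<in> {0..1}"
  by (cases x) (auto simp: unit_square_def)

lemma abs_le_supnorm:
  assumes "continuous_on unit_square g" "x \<in> unit_square"
  shows "\<bar>g x\<bar> \<le> supnorm g"
proof -
  have "compact ((\<lambda>x. \<bar>g x\<bar>) ` unit_square)"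
    using assms(1) unfolding unit_square_eq_cbox
    by (intro compact_continuous_image continuous_intros compact_cbox)
  then have "bdd_above ((\<lambda>x. \<bar>g x\<bar>) ` unit_square)"
    by (intro bounded_imp_bdd_above compact_imp_bounded)
  then show ?thesis
    unfolding supnorm_def using assms(2) by (intro cSUP_upper)
qed

lemma supnorm_nonneg:
  assumes "continuous_on unit_square g"
  shows "0 \<le> supnorm g"
  using abs_le_supnorm[OF assms, of "(0, 0)"] by (simp add: mem_unit_square_iff)

lemma supnorm_le:
  assumes "\<And>x. x \<in> unit_square \<Longrightarrow> \<bar>g x\<bar> \<le> B"
  shows "supnorm g \<le> B"
  unfolding supnorm_def
  by (rule cSUP_least) (use assms in \<open>auto simp: unit_square_def\<close>)

lemma Ck_square_imp_continuous: "Ck_square k f \<Longrightarrow> continuous_on unit_square f"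
  by (cases k) auto

lemma Ck_square_Suc_pd1:
  assumes "Ck_square (Suc k) f" "(t, y) \<in> unit_square"
  shows "((\<lambda>t. f (t, y)) has_field_derivative pd1 f (t, y)) (at t within {0..1})"
proof -
  have "(\<lambda>t. f (t, y)) differentiable (at t within {0..1})"
    using assms by fastforce
  then show ?thesis
    unfolding vector_derivative_works pd1_def has_real_derivative_iff_has_vector_derivative by simp
qed

lemma Ck_square_Suc_pd2:
  assumes "Ck_square (Suc k) f" "(x, t) \<in> unit_square"
  shows "((\<lambda>t. f (x, t)) has_field_derivative pd2 f (x, t)) (at t within {0..1})"
proof -
  have "(\<lambda>t. f (x, t)) differentiable (at t within {0..1})"
    using assms by fastforce
  then show ?thesis
    unfolding vector_derivative_works pd2_def has_real_derivative_iff_has_vector_derivative by simp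
qed

lemma Ck_square_2_continuous_pd:
  assumes "Ck_square 2 f"
  shows "continuous_on unit_square (pd 1 0 f)" "continuous_on unit_square (pd 0 1 f)"
    "continuous_on unit_square (pd 2 0 f)" "continuous_on unit_square (pd 1 1 f)"
    "continuous_on unit_square (pd 0 2 f)"
  using assms by (simp_all add: numeral_2_eq_2 pd_def)

lemma lipschitz_square:
  assumes "Ck_square 1 f" "u \<in> unit_square" "c \<in> unit_square"
  shows "\<bar>f u - f c\<bar> \<le> supnorm (pd 1 0 f) * \<bar>fst u - fst c\<bar> + supnorm (pd 0 1 f) * \<bar>snd u - snd c\<bar>"
proof -
  obtain u1 u2 c1 c2 where [simp]: "u = (u1, u2)" "c = (c1, c2)"
    by (cases u, cases c)
  have C: "Ck_square (Suc 0) f" using assms by simp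
  have cont: "continuous_on unit_square (pd 1 0 f)" "continuous_on unit_square (pd 0 1 f)"
    using C by (simp_all add: pd_def)
  have "norm (f (u1, u2) - f (c1, u2)) \<le> supnorm (pd 1 0 f) * norm (u1 - c1)"
    using assms abs_le_supnorm[OF cont(1)]
    by (intro field_differentiable_bound[of "{0..1}" "\<lambda>t. f (t, u2)" "\<lambda>t. pd1 f (t, u2)"]
        Ck_square_Suc_pd1[OF C]) (auto simp: mem_unit_square_iff pd_def)
  moreover have "norm (f (c1, u2) - f (c1, c2)) \<le> supnorm (pd 0 1 f) * norm (u2 - c2)"
    using assms abs_le_supnorm[OF cont(2)]
    by (intro field_differentiable_bound[of "{0..1}" "\<lambda>t. f (c1, t)" "\<lambda>t. pd2 f (c1, t)"]
        Ck_square_Suc_pd2[OF C]) (auto simp: mem_unit_square_iff pd_def)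
  ultimately show ?thesis by simp
qed

text \<open>
  The sharp constant is \<open>B / 2\<close>. The weaker constant \<open>B\<close> is what the general Taylor estimate
  yields directly, and the factor \<open>1 / 4\<close> in the variance of a Beta distribution absorbs the loss.
\<close>
lemma taylor_remainder_interval:
  fixes g :: "real \<Rightarrow> real"
  assumes "\<And>t. t \<in> {0..1} \<Longrightarrow> (g has_field_derivative g' t) (at t within {0..1})"
    and "\<And>t. t \<in> {0..1} \<Longrightarrow> (g' has_field_derivative g'' t) (at t within {0..1})"
    and "\<And>t. t \<in> {0..1} \<Longrightarrow> \<bar>g'' t\<bar> \<le> B" "u \<in> {0..1}" "c \<in> {0..1}"
  shows "\<bar>g u - g c - g' c * (u - c)\<bar> \<le> B * (u - c)\<^sup>2"
proof -
  define F where "F i = (if i = 0 then g else if i = 1 then g' else g'')" for i :: nat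
  have "norm (F 0 u - (\<Sum>i\<le>1. F i c * (u - c) ^ i / fact i)) \<le> B * norm (u - c) ^ Suc 1 / fact 1"
    by (rule field_Taylor[of "{0..1}"]) (use assms in \<open>auto simp: F_def le_Suc_eq\<close>)
  then show ?thesis
    by (simp add: F_def diff_diff_eq flip: power2_eq_square)
qed

text \<open>
  The mean value theorem in the second variable, applied to \<open>f (u\<^sub>1, t) - f (c\<^sub>1, t)\<close>, whose
  derivative in \<open>t\<close> is in turn estimated by the mean value theorem in the first variable.
  The bound thus involves the mixed derivative in exactly the order that \<open>pd 1 1 f\<close> prescribes.
\<close>
lemma mixed_difference_bound:
  assumes "Ck_square 2 f" "(u1, u2) \<in> unit_square" "(c1, c2) \<in> unit_square"
  shows "\<bar>f (u1, u2) - f (c1, u2) - f (u1, c2) + f (c1, c2)\<bar>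
    \<le> supnorm (pd 1 1 f) * \<bar>u1 - c1\<bar> * \<bar>u2 - c2\<bar>"
proof -
  have C: "Ck_square (Suc (Suc 0)) f" and C': "Ck_square (Suc 0) (pd2 f)"
    using assms(1) by (simp_all add: numeral_2_eq_2)
  have b: "norm (pd2 f (u1, t) - pd2 f (c1, t)) \<le> supnorm (pd 1 1 f) * norm (u1 - c1)"
    if "t \<in> {0..1}" for t
    using assms that abs_le_supnorm[OF Ck_square_2_continuous_pd(4)[OF assms(1)]]
    by (intro field_differentiable_bound[of "{0..1}" "\<lambda>s. pd2 f (s, t)" "\<lambda>s. pd1 (pd2 f) (s, t)"]
        Ck_square_Suc_pd1[OF C']) (auto simp: mem_unit_square_iff pd_def)
  have "norm ((f (u1, u2) - f (c1, u2)) - (f (u1, c2) - f (c1, c2)))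
    \<le> (supnorm (pd 1 1 f) * norm (u1 - c1)) * norm (u2 - c2)"
    using assms b
    by (intro field_differentiable_bound[of "{0..1}" "\<lambda>t. f (u1, t) - f (c1, t)"
          "\<lambda>t. pd2 f (u1, t) - pd2 f (c1, t)"] DERIV_diff Ck_square_Suc_pd2[OF C])
      (auto simp: mem_unit_square_iff)
  then show ?thesis by (simp add: algebra_simps)
qed

text \<open>
  Moving from \<open>c\<close> to \<open>u\<close> splits exactly into two one-dimensional increments through \<open>c\<close> and the
  mixed second difference. The product of the two coordinate distances in the latter is
  separated by the weighted inequality \<open>2ab \<le> s a\<^sup>2 + b\<^sup>2 / s\<close>, so that afterwards only the
  variances have to be integrated; \<open>s\<close> is kept free in order to balance \<open>m\<close> against \<open>n\<close> later.
\<close>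
lemma taylor_remainder_square:
  assumes C2: "Ck_square 2 f" and u: "u \<in> unit_square" and c: "c \<in> unit_square" and s: "s > 0"
  shows "\<bar>f u - f c - pd 1 0 f c * (fst u - fst c) - pd 0 1 f c * (snd u - snd c)\<bar>
    \<le> (supnorm (pd 2 0 f) + supnorm (pd 1 1 f) * s / 2) * (fst u - fst c)\<^sup>2
      + (supnorm (pd 0 2 f) + supnorm (pd 1 1 f) / (2 * s)) * (snd u - snd c)\<^sup>2"
proof -
  obtain u1 u2 c1 c2 where [simp]: "u = (u1, u2)" "c = (c1, c2)"
    by (cases u, cases c)
  note cont = Ck_square_2_continuous_pd[OF C2]
  have C: "Ck_square (Suc (Suc 0)) f" and C': "Ck_square (Suc 0) (pd1 f)" "Ck_square (Suc 0) (pd2 f)"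
    using C2 by (simp_all add: numeral_2_eq_2)
  have 1: "\<bar>f (u1, c2) - f (c1, c2) - pd 1 0 f c * (u1 - c1)\<bar> \<le> supnorm (pd 2 0 f) * (u1 - c1)\<^sup>2"
    using u c abs_le_supnorm[OF cont(3)] unfolding pd_def
    by (simp, intro taylor_remainder_interval[where g = "\<lambda>t. f (t, c2)" and g' = "\<lambda>t. pd1 f (t, c2)"
          and g'' = "\<lambda>t. pd1 (pd1 f) (t, c2)"]
        Ck_square_Suc_pd1[OF C] Ck_square_Suc_pd1[OF C'(1)])
      (auto simp: mem_unit_square_iff numeral_2_eq_2)
  have 2: "\<bar>f (c1, u2) - f (c1, c2) - pd 0 1 f c * (u2 - c2)\<bar> \<le> supnorm (pd 0 2 f) * (u2 - c2)\<^sup>2"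
    using u c abs_le_supnorm[OF cont(5)] unfolding pd_def
    by (simp, intro taylor_remainder_interval[where g = "\<lambda>t. f (c1, t)" and g' = "\<lambda>t. pd2 f (c1, t)"
          and g'' = "\<lambda>t. pd2 (pd2 f) (c1, t)"]
        Ck_square_Suc_pd2[OF C] Ck_square_Suc_pd2[OF C'(2)])
      (auto simp: mem_unit_square_iff numeral_2_eq_2)
  have "2 * s * (\<bar>u1 - c1\<bar> * \<bar>u2 - c2\<bar>) \<le> s\<^sup>2 * (u1 - c1)\<^sup>2 + (u2 - c2)\<^sup>2"
    using zero_le_power2[of "s * \<bar>u1 - c1\<bar> - \<bar>u2 - c2\<bar>"]
    by (simp add: power2_diff power_mult_distrib algebra_simps)
  then have amgm: "\<bar>u1 - c1\<bar> * \<bar>u2 - c2\<bar> \<le> s / 2 * (u1 - c1)\<^sup>2 + (u2 - c2)\<^sup>2 / (2 * s)"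
    using s by (simp add: field_simps power2_eq_square)
  have 3: "\<bar>f (u1, u2) - f (c1, u2) - f (u1, c2) + f (c1, c2)\<bar>
    \<le> supnorm (pd 1 1 f) * (s / 2 * (u1 - c1)\<^sup>2 + (u2 - c2)\<^sup>2 / (2 * s))"
    using mixed_difference_bound[OF C2, of u1 u2 c1 c2] u c
      mult_left_mono[OF amgm supnorm_nonneg[OF cont(4)]] by simp
  show ?thesis
    using 1 2 3 by (simp add: algebra_simps abs_le_iff)
qed

section \<open>The Beta distribution\<close>

text \<open>
  The density of the Beta distribution with parameters \<open>k + 1\<close> and \<open>m - k + 1\<close> on the unit
  interval. These integer parameters are the ones that the moment formula produces.
\<close>
definition beta_density :: "nat \<Rightarrow> nat \<Rightarrow> real \<Rightarrow> real" where
  "beta_density m k u = fact (Suc m) / (fact k * fact (m - k)) * u ^ k * (1 - u) ^ (m - k)"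

lemma beta_density_nonneg: "u \<in> {0..1} \<Longrightarrow> 0 \<le> beta_density m k u"
  by (auto simp: beta_density_def)

lemma continuous_on_beta_density [continuous_intros]:
  "continuous_on A g \<Longrightarrow> continuous_on A (\<lambda>x. beta_density m k (g x))"
  unfolding beta_density_def by (intro continuous_intros)

lemma has_integral_beta_density:
  assumes "k \<le> m"
  shows "(beta_density m k has_integral 1) {0..1}"
proof -
  have "((\<lambda>t. t powr (real (Suc k) - 1) * (1 - t) powr (real (Suc (m - k)) - 1))
      has_integral Beta (real (Suc k)) (real (Suc (m - k)))) {0..1}"
    by (rule has_integral_Beta_real) auto
  then have "((\<lambda>t. t ^ k * (1 - t) ^ (m - k))
      has_integral Beta (real (Suc k)) (real (Suc (m - k)))) {0..1}"
    by (rule has_integral_spike_finite[of "{0, 1}", rotated 2]) (auto simp: powr_realpow)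
  moreover have "Beta (real (Suc k)) (real (Suc (m - k))) = fact k * fact (m - k) / fact (Suc m)"
    using assms Gamma_fact[of k, where 'a = real] Gamma_fact[of "m - k", where 'a = real]
      Gamma_fact[of "Suc m", where 'a = real]
    by (simp add: Beta_def of_nat_diff add_ac)
  ultimately have "((\<lambda>t::real. t ^ k * (1 - t) ^ (m - k))
      has_integral fact k * fact (m - k) / fact (Suc m)) {0..1}" by simp
  from has_integral_mult_right[OF this, of "fact (Suc m) / (fact k * fact (m - k))"]
  show ?thesis
    by (simp add: beta_density_def[abs_def] mult.assoc del: fact_Suc)
qed

text \<open>
  Multiplying by the variable stays within the family of densities. Since each of them
  integrates to one, mean and variance can be read off without further integration.
\<close>
lemma mult_beta_density:
  assumes "k \<le> m"
  shows "u * beta_density m k u = (real k + 1) / (real m + 2) * beta_density (Suc m) (Suc k) u"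
  using assms by (simp add: beta_density_def divide_simps) (simp add: algebra_simps)

definition beta_mean :: "nat \<Rightarrow> nat \<Rightarrow> real" where
  "beta_mean m k = (real k + 1) / (real m + 2)"

lemma beta_mean_mem: "k \<le> m \<Longrightarrow> beta_mean m k \<in> {0..1}"
  by (simp add: beta_mean_def)

lemma beta_density_mean:
  assumes "k \<le> m"
  shows "((\<lambda>u. (u - beta_mean m k) * beta_density m k u) has_integral 0) {0..1}"
proof -
  have "((\<lambda>u. beta_mean m k * beta_density (Suc m) (Suc k) u - beta_mean m k * beta_density m k u)
      has_integral beta_mean m k * 1 - beta_mean m k * 1) {0..1}"
    using assms by (intro has_integral_diff has_integral_mult_right has_integral_beta_density) auto
  then show ?thesis
    using mult_beta_density[OF assms] by (simp add: beta_mean_def algebra_simps)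
qed

text \<open>
  The variance is \<open>\<mu> (1 - \<mu>) / (m + 3)\<close> for the mean \<open>\<mu>\<close>, and \<open>\<mu> (1 - \<mu>) \<le> 1 / 4\<close>.
\<close>
lemma beta_density_variance:
  assumes "k \<le> m"
  obtains V where "((\<lambda>u. (u - beta_mean m k)\<^sup>2 * beta_density m k u) has_integral V) {0..1}"
    "V \<le> 1 / (4 * (real m + 2))"
proof
  let ?c = "beta_mean m k"
  let ?q = "(real k + 1) / (real m + 2) * ((real k + 2) / (real m + 3))"
  let ?V = "?q * 1 - 2 * ?c * (?c * 1) + ?c\<^sup>2 * 1"
  have *: "(u - ?c)\<^sup>2 * beta_density m k u = ?q * beta_density (Suc (Suc m)) (Suc (Suc k)) u
      - 2 * ?c * (?c * beta_density (Suc m) (Suc k) u) + ?c\<^sup>2 * beta_density m k u" for u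
  proof -
    have "(u - ?c)\<^sup>2 * beta_density m k u
      = u * (u * beta_density m k u) - 2 * ?c * (u * beta_density m k u) + ?c\<^sup>2 * beta_density m k u"
      by (simp add: power2_eq_square algebra_simps)
    also have "u * beta_density m k u = ?c * beta_density (Suc m) (Suc k) u"
      unfolding beta_mean_def by (rule mult_beta_density[OF assms])
    also have "u * (?c * beta_density (Suc m) (Suc k) u) = ?c * (u * beta_density (Suc m) (Suc k) u)"
      by simp
    also have "u * beta_density (Suc m) (Suc k) u
        = (real k + 2) / (real m + 3) * beta_density (Suc (Suc m)) (Suc (Suc k)) u"
      using mult_beta_density[of "Suc k" "Suc m" u] assms by (simp add: add_ac)
    finally show ?thesis by (simp add: beta_mean_def)
  qed
  show "((\<lambda>u. (u - ?c)\<^sup>2 * beta_density m k u) has_integral ?V) {0..1}"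
    unfolding *
    using assms by (intro has_integral_diff has_integral_add has_integral_mult_right
        has_integral_beta_density) auto
  have V: "?V = (real k + 1) * (real m - real k + 1) / ((real m + 2)\<^sup>2 * (real m + 3))"
    by (simp add: beta_mean_def divide_simps power2_eq_square) (simp add: algebra_simps)
  \<comment> \<open>The difference of the two sides is \<open>(2 k - m)\<^sup>2\<close>.\<close>
  have "4 * ((real k + 1) * (real m - real k + 1)) \<le> (real m + 2)\<^sup>2"
    using zero_le_power2[of "2 * real k - real m"] by (simp add: power2_eq_square algebra_simps)
  then have "?V \<le> ((real m + 2)\<^sup>2 / 4) / ((real m + 2)\<^sup>2 * (real m + 3))"
    unfolding V by (intro divide_right_mono) auto
  also have "\<dots> = 1 / (4 * (real m + 3))"
    by (simp add: divide_simps)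
  also have "\<dots> \<le> 1 / (4 * (real m + 2))"
    by (simp add: divide_simps)
  finally show "?V \<le> 1 / (4 * (real m + 2))" .
qed

section \<open>The approximation as an average against Beta densities\<close>

definition beta_average :: "nat \<Rightarrow> nat \<Rightarrow> nat \<Rightarrow> nat \<Rightarrow> (real \<times> real \<Rightarrow> real) \<Rightarrow> real" where
  "beta_average m n k l h =
    integral unit_square (\<lambda>u. beta_density m k (fst u) * beta_density n l (snd u) * h u)"

lemma integrable_beta_average:
  assumes "continuous_on unit_square h"
  shows "(\<lambda>u. beta_density m k (fst u) * beta_density n l (snd u) * h u) integrable_on unit_square"
  using assms unfolding unit_square_eq_cbox
  by (intro integrable_continuous continuous_intros)

lemma beta_average_add:
  assumes "continuous_on unit_square g" "continuous_on unit_square h"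
  shows "beta_average m n k l (\<lambda>u. g u + h u) = beta_average m n k l g + beta_average m n k l h"
  unfolding beta_average_def distrib_left
  by (intro integral_add integrable_beta_average assms)

lemma beta_average_cmult: "beta_average m n k l (\<lambda>u. c * h u) = c * beta_average m n k l h"
  unfolding beta_average_def by (simp flip: integral_mult_right add: mult_ac)

lemma beta_average_abs_le:
  assumes "continuous_on unit_square g" "continuous_on unit_square h"
    and "\<And>u. u \<in> unit_square \<Longrightarrow> \<bar>g u\<bar> \<le> h u"
  shows "\<bar>beta_average m n k l g\<bar> \<le> beta_average m n k l h"
  unfolding beta_average_def real_norm_def[symmetric]
  by (intro Henstock_Kurzweil_Integration.integral_norm_bound_integral integrable_beta_average assms)
    (auto simp: abs_mult beta_density_nonneg mem_unit_square_iff intro!: mult_left_mono assms(3))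

text \<open>
  Independence of the two coordinates, by Fubini.
\<close>
lemma beta_average_prod:
  assumes p: "((\<lambda>t. p t * beta_density m k t) has_integral P) {0..1}" "continuous_on {0..1} p"
    and q: "((\<lambda>t. q t * beta_density n l t) has_integral Q) {0..1}" "continuous_on {0..1} q"
  shows "beta_average m n k l (\<lambda>u. p (fst u) * q (snd u)) = P * Q"
proof -
  have "continuous_on (cbox (0, 0) (1, 1))
      (\<lambda>u. (p (fst u) * beta_density m k (fst u)) * (q (snd u) * beta_density n l (snd u)))"
    by (intro continuous_intros continuous_on_compose2[OF p(2)] continuous_on_compose2[OF q(2)])
      (auto simp: cbox_Pair_eq)
  from integral_prod_continuous[OF this]
  have "beta_average m n k l (\<lambda>u. p (fst u) * q (snd u))
      = integral {0..1} (\<lambda>x. integral {0..1}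
          (\<lambda>y. (p x * beta_density m k x) * (q y * beta_density n l y)))"
    by (simp add: beta_average_def unit_square_eq_cbox mult_ac)
  also have "\<dots> = integral {0..1} (\<lambda>x. (p x * beta_density m k x) * Q)"
    by (simp only: integral_mult_right integral_unique[OF q(1)])
  also have "\<dots> = P * Q"
    using integral_unique[OF p(1)] by simp
  finally show ?thesis .
qed

text \<open>
  A function supported in the square may jump at the boundary, so it need not be continuous on
  the plane; continuity on the closed square makes the restricted integrand integrable.
\<close>
lemma moment_eq_integral:
  assumes "closed_support f \<subseteq> unit_square" "continuous_on unit_square f"
  shows "moment a b f = integral unit_square (\<lambda>u. fst u ^ a * snd u ^ b * f u)"
proof -
  have "f u = 0" if "u \<notin> unit_square" for u
    using assms(1) that closure_subset[of "{x. f x \<noteq> 0}"] by (auto simp: closed_support_def)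
  then have "moment a b f = (LINT u:unit_square|lebesgue. fst u ^ a * snd u ^ b * f u)"
    unfolding moment_def set_lebesgue_integral_def
    by (intro Bochner_Integration.integral_cong) (auto simp: indicator_def)
  also have "\<dots> = integral unit_square (\<lambda>u. fst u ^ a * snd u ^ b * f u)"
    using assms(2) unfolding unit_square_eq_cbox
    by (intro set_lebesgue_integral_eq_integral absolutely_integrable_continuous continuous_intros)
  finally show ?thesis .
qed

lemma beta_density_expansion:
  assumes "k \<le> m"
  shows "beta_density m k u
    = fact (Suc m) / fact k * (\<Sum>a = 0..m - k. (- 1) ^ a * u ^ (a + k) / (fact a * fact (m - k - a)))"
proof -
  have "(1 - u) ^ (m - k) = (\<Sum>a\<le>m - k. of_nat (m - k choose a) * (- u) ^ a * 1 ^ (m - k - a))"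
    using binomial_ring[of "- u" 1 "m - k"] by simp
  also have "\<dots> = (\<Sum>a = 0..m - k. fact (m - k) * ((- 1) ^ a * u ^ a / (fact a * fact (m - k - a))))"
    unfolding atMost_atLeast0
    by (intro sum.cong) (auto simp: binomial_fact power_minus[of u])
  finally have *: "(1 - u) ^ (m - k)
    = fact (m - k) * (\<Sum>a = 0..m - k. (- 1) ^ a * u ^ a / (fact a * fact (m - k - a)))"
    by (simp add: sum_distrib_left)
  show ?thesis
    unfolding beta_density_def *
    by (simp add: sum_distrib_left power_add mult_ac del: fact_Suc)
qed

lemma nat_floor_mult_le:
  assumes "t \<in> {0..1}"
  shows "nat \<lfloor>real m * t\<rfloor> \<le> m"
proof -
  have "real m * t \<le> real m"
    using assms by (simp add: mult_left_le)
  then show ?thesis by linarith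
qed

text \<open>
  Linearity of the integral turns the sum of moments into one integral, whose kernel is the
  product of the binomial expansions of the two densities.
\<close>
lemma app_eq_beta_average:
  assumes supp: "closed_support f \<subseteq> unit_square" and cont: "continuous_on unit_square f"
    and x: "x \<in> unit_square"
  shows "app m n f x = beta_average m n (nat \<lfloor>real m * fst x\<rfloor>) (nat \<lfloor>real n * snd x\<rfloor>) f"
proof -
  define k where "k = nat \<lfloor>real m * fst x\<rfloor>"
  define l where "l = nat \<lfloor>real n * snd x\<rfloor>"
  have x': "0 \<le> fst x" "fst x \<le> 1" "0 \<le> snd x" "snd x \<le> 1"
    using x by (auto simp: mem_unit_square_iff)
  have kl: "k \<le> m" "l \<le> n"
    using x' by (auto simp: k_def l_def intro!: nat_floor_mult_le)
  have fl: "of_int \<lfloor>real m * fst x\<rfloor> = real k" "of_int \<lfloor>real n * snd x\<rfloor> = real l"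
    using x' by (simp_all add: k_def l_def)
  have C: "app_coeff m n x = (fact (Suc m) / fact k) * (fact (Suc n) / fact l)"
    using Gamma_fact[of k, where 'a = real] Gamma_fact[of l, where 'a = real]
      Gamma_fact[of "Suc m", where 'a = real] Gamma_fact[of "Suc n", where 'a = real]
    unfolding app_coeff_def fl by (simp add: add_ac)
  let ?w = "\<lambda>a b. (- 1) ^ (a + b) / (fact a * fact b * fact (m - k - a) * fact (n - l - b)) :: real"
  have int: "(\<lambda>u. ?w a b * (fst u ^ (a + k) * snd u ^ (b + l) * f u)) integrable_on unit_square" for a b
    using cont unfolding unit_square_eq_cbox by (intro integrable_continuous continuous_intros) auto
  have dens: "app_coeff m n x * (\<Sum>a = 0..m - k. \<Sum>b = 0..n - l.
      ?w a b * (fst u ^ (a + k) * snd u ^ (b + l) * f u))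
    = beta_density m k (fst u) * beta_density n l (snd u) * f u" for u
  proof -
    have "(\<Sum>a = 0..m - k. \<Sum>b = 0..n - l. ?w a b * (fst u ^ (a + k) * snd u ^ (b + l) * f u))
      = (\<Sum>a = 0..m - k. (- 1) ^ a * fst u ^ (a + k) / (fact a * fact (m - k - a)))
        * (\<Sum>b = 0..n - l. (- 1) ^ b * snd u ^ (b + l) / (fact b * fact (n - l - b))) * f u"
      unfolding sum_product unfolding sum_distrib_right by (intro sum.cong) (simp_all add: power_add mult_ac)
    then show ?thesis
      unfolding C beta_density_expansion[OF kl(1)] beta_density_expansion[OF kl(2)]
      by (simp only: mult_ac)
  qed
  have "app m n f x = app_coeff m n x * (\<Sum>a = 0..m - k. \<Sum>b = 0..n - l.
      ?w a b * integral unit_square (\<lambda>u. fst u ^ (a + k) * snd u ^ (b + l) * f u))"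
    by (simp add: app_def Let_def moment_eq_integral[OF supp cont] flip: k_def l_def)
  also have "\<dots> = app_coeff m n x * integral unit_square (\<lambda>u. \<Sum>a = 0..m - k. \<Sum>b = 0..n - l.
      ?w a b * (fst u ^ (a + k) * snd u ^ (b + l) * f u))"
    using int by (simp add: integral_sum integrable_sum)
  also have "\<dots> = beta_average m n k l f"
    unfolding beta_average_def dens[symmetric] by simp
  finally show ?thesis by (simp add: k_def l_def)
qed

section \<open>The error bound\<close>

text \<open>
  Average the second-order expansion around the point of means: the constant is reproduced, the
  linear part vanishes, and the remainder becomes a combination of the two variances.
\<close>
lemma beta_average_error:
  assumes C2: "Ck_square 2 f" and kl: "k \<le> m" "l \<le> n"
  shows "\<bar>beta_average m n k l f - f (beta_mean m k, beta_mean n l)\<bar>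
    \<le> supnorm (pd 2 0 f) / (4 * (real m + 2)) + supnorm (pd 0 2 f) / (4 * (real n + 2))
      + supnorm (pd 1 1 f) / (4 * sqrt ((real m + 2) * (real n + 2)))"
proof -
  let ?E = "beta_average m n k l"
  define c where "c = (beta_mean m k, beta_mean n l)"
  \<comment> \<open>The weight \<open>s = M / N\<close> is the ratio of the standard deviation bounds \<open>1 / (2 N)\<close> and
    \<open>1 / (2 M)\<close>; it makes both halves of the mixed term equal to the geometric mean.\<close>
  define M N where "M = sqrt (real m + 2)" and "N = sqrt (real n + 2)"
  have MN: "M > 0" "N > 0" "real m + 2 = M\<^sup>2" "real n + 2 = N\<^sup>2"
    by (auto simp: M_def N_def)
  define s where "s = M / N"
  have s: "s > 0" using MN by (simp add: s_def)
  have c: "c \<in> unit_square"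
    using kl beta_mean_mem by (simp add: c_def mem_unit_square_iff)
  note cont = Ck_square_2_continuous_pd[OF C2] Ck_square_imp_continuous[OF C2]
  define A where "A = supnorm (pd 2 0 f) + supnorm (pd 1 1 f) * s / 2"
  define B where "B = supnorm (pd 0 2 f) + supnorm (pd 1 1 f) / (2 * s)"
  have AB: "0 \<le> A" "0 \<le> B"
    using s cont by (auto simp: A_def B_def supnorm_nonneg)
  define L where "L u = pd 1 0 f c * (fst u - fst c) + pd 0 1 f c * (snd u - snd c)" for u
  obtain V where V: "((\<lambda>u. (u - fst c)\<^sup>2 * beta_density m k u) has_integral V) {0..1}"
    "V \<le> 1 / (4 * (real m + 2))"
    using beta_density_variance[OF kl(1)] by (auto simp: c_def)
  obtain W where W: "((\<lambda>u. (u - snd c)\<^sup>2 * beta_density n l u) has_integral W) {0..1}"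
    "W \<le> 1 / (4 * (real n + 2))"
    using beta_density_variance[OF kl(2)] by (auto simp: c_def)
  have one: "((\<lambda>t. 1 * beta_density m k t) has_integral 1) {0..1}"
    "((\<lambda>t. 1 * beta_density n l t) has_integral 1) {0..1}"
    using has_integral_beta_density kl by simp_all
  have E1: "?E (\<lambda>u. 1) = 1"
    using beta_average_prod[OF one(1) _ one(2)] by simp
  have EV: "?E (\<lambda>u. (fst u - fst c)\<^sup>2) = V"
    using beta_average_prod[OF V(1) _ one(2)] by (simp add: continuous_intros)
  have EW: "?E (\<lambda>u. (snd u - snd c)\<^sup>2) = W"
    using beta_average_prod[OF one(1) _ W(1)] by (simp add: continuous_intros)
  have m1: "?E (\<lambda>u. fst u - fst c) = 0"
    using beta_average_prod[OF beta_density_mean[OF kl(1)] _ one(2)]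
    by (simp add: continuous_intros c_def)
  have m2: "?E (\<lambda>u. snd u - snd c) = 0"
    using beta_average_prod[OF one(1) _ beta_density_mean[OF kl(2)]]
    by (simp add: continuous_intros c_def)
  have EL: "?E L = 0"
    unfolding L_def
    by (subst beta_average_add) (auto simp: beta_average_cmult m1 m2 intro!: continuous_intros)
  have contL: "continuous_on unit_square L"
    unfolding L_def by (intro continuous_intros)
  have "?E f = ?E (\<lambda>u. (f u - f c - L u) + (f c * 1 + L u))"
    by simp
  also have "\<dots> = ?E (\<lambda>u. f u - f c - L u) + ?E (\<lambda>u. f c * 1 + L u)"
    using cont contL by (intro beta_average_add continuous_intros)
  also have "?E (\<lambda>u. f c * 1 + L u) = f c * ?E (\<lambda>u. 1) + ?E L"
    using contL unfolding beta_average_cmult[symmetric] by (intro beta_average_add continuous_intros)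
  finally have "?E f - f c = ?E (\<lambda>u. f u - f c - L u)"
    by (simp add: E1 EL)
  also have "\<bar>\<dots>\<bar> \<le> ?E (\<lambda>u. A * (fst u - fst c)\<^sup>2 + B * (snd u - snd c)\<^sup>2)"
    using taylor_remainder_square[OF C2 _ c s] cont contL
    by (intro beta_average_abs_le continuous_intros) (auto simp: L_def A_def B_def algebra_simps)
  also have "\<dots> = A * V + B * W"
    by (subst beta_average_add) (auto simp: beta_average_cmult EV EW intro!: continuous_intros)
  also have "\<dots> \<le> A * (1 / (4 * (real m + 2))) + B * (1 / (4 * (real n + 2)))"
    using AB V W by (intro add_mono mult_left_mono)
  also have "\<dots> = supnorm (pd 2 0 f) / (4 * (real m + 2)) + supnorm (pd 0 2 f) / (4 * (real n + 2))
      + supnorm (pd 1 1 f) / (4 * sqrt ((real m + 2) * (real n + 2)))"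
    using MN unfolding A_def B_def s_def real_sqrt_mult M_def[symmetric] N_def[symmetric]
    by (simp add: field_simps power2_eq_square)
  finally show ?thesis by (simp add: c_def)
qed

text \<open>
  Over the denominator \<open>m + 2\<close> the difference has numerator \<open>1 - \<delta> - 2t\<close>, where \<open>\<delta>\<close> is the
  fractional part of \<open>m t\<close>; it lies between \<open>-2\<close> and \<open>1\<close>.
\<close>
lemma abs_beta_mean_diff_le:
  assumes "t \<in> {0..1}"
  shows "\<bar>beta_mean m (nat \<lfloor>real m * t\<rfloor>) - t\<bar> \<le> 2 / (real m + 2)"
proof -
  define k where "k = nat \<lfloor>real m * t\<rfloor>"
  have "0 \<le> real m * t" using assms by simp
  then have "real k \<le> real m * t" "real m * t < real k + 1"
    unfolding k_def by linarith+
  then have "\<bar>real k + 1 - t * (real m + 2)\<bar> \<le> 2"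
    using assms by (simp add: abs_le_iff algebra_simps)
  moreover have "beta_mean m k - t = (real k + 1 - t * (real m + 2)) / (real m + 2)"
    by (simp add: beta_mean_def field_simps)
  ultimately show ?thesis
    by (simp add: k_def abs_divide divide_right_mono)
qed

text \<open>
  The triangle inequality through the value of \<open>f\<close> at the point of means, which uses only
  half of each second-derivative term of the bound.
\<close>
lemma app_error:
  assumes supp: "closed_support f \<subseteq> unit_square" and C2: "Ck_square 2 f" and x: "x \<in> unit_square"
  shows "\<bar>app m n f x - f x\<bar>
    \<le> (2 * supnorm (pd 1 0 f) + 1/2 * supnorm (pd 2 0 f)) / (real m + 2)
      + (2 * supnorm (pd 0 1 f) + 1/2 * supnorm (pd 0 2 f)) / (real n + 2)
      + 1/2 * supnorm (pd 1 1 f) / sqrt ((real m + 2) * (real n + 2))"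
proof -
  define k where "k = nat \<lfloor>real m * fst x\<rfloor>"
  define l where "l = nat \<lfloor>real n * snd x\<rfloor>"
  define c where "c = (beta_mean m k, beta_mean n l)"
  have x': "fst x \<in> {0..1}" "snd x \<in> {0..1}"
    using x by (auto simp: mem_unit_square_iff)
  have kl: "k \<le> m" "l \<le> n"
    using x' by (auto simp: k_def l_def intro!: nat_floor_mult_le)
  have c: "c \<in> unit_square"
    using kl beta_mean_mem by (simp add: c_def mem_unit_square_iff)
  note cont = Ck_square_2_continuous_pd[OF C2] Ck_square_imp_continuous[OF C2]
  note nonneg = supnorm_nonneg[OF cont(1)] supnorm_nonneg[OF cont(2)] supnorm_nonneg[OF cont(3)]
    supnorm_nonneg[OF cont(4)] supnorm_nonneg[OF cont(5)]
  have half: "a / (4 * d) \<le> 1/2 * a / d" if "0 \<le> a" "0 < d" for a d :: real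
    using that by (simp add: divide_simps)
  have "Ck_square 1 f"
    using C2 by (simp add: numeral_2_eq_2)
  from lipschitz_square[OF this c x]
  have "\<bar>f c - f x\<bar> \<le> supnorm (pd 1 0 f) * (2 / (real m + 2)) + supnorm (pd 0 1 f) * (2 / (real n + 2))"
    using mult_left_mono[OF abs_beta_mean_diff_le[OF x'(1), of m] nonneg(1)]
      mult_left_mono[OF abs_beta_mean_diff_le[OF x'(2), of n] nonneg(2)]
    by (simp add: c_def k_def l_def)
  moreover have "supnorm (pd 2 0 f) / (4 * (real m + 2)) \<le> 1/2 * supnorm (pd 2 0 f) / (real m + 2)"
    "supnorm (pd 0 2 f) / (4 * (real n + 2)) \<le> 1/2 * supnorm (pd 0 2 f) / (real n + 2)"
    using nonneg by (intro half; simp)+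
  moreover have "supnorm (pd 1 1 f) / (4 * sqrt ((real m + 2) * (real n + 2)))
      \<le> 1/2 * supnorm (pd 1 1 f) / sqrt ((real m + 2) * (real n + 2))"
    using nonneg by (intro half; simp)
  ultimately show ?thesis
    using beta_average_error[OF C2 kl] app_eq_beta_average[OF supp cont(6) x, of m n]
    unfolding add_divide_distrib by (simp add: c_def flip: k_def l_def)
qed

theorem theorem5p2:
  fixes f :: "real \<times> real \<Rightarrow> real" and C :: real
  assumes "f \<in> borel_measurable lebesgue"
    and "closed_support f \<subseteq> unit_square"
    and "moment_determinate f"
    and "(LINT x:unit_square|lebesgue. f x) = 1"
    and "Ck_square 2 f"
  defines "C \<equiv> 2 * (supnorm (pd 1 0 f) + supnorm (pd 0 1 f)) +
               1/2 * (supnorm (pd 2 0 f) + supnorm (pd 1 1 f) + supnorm (pd 0 2 f))"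
  shows "uniform_limit unit_square (\<lambda>(m, n). app m n f) f (sequentially \<times>\<^sub>F sequentially) \<and>
    (\<exists>r1 r2 :: nat \<Rightarrow> real. \<exists>r3 :: nat \<times> nat \<Rightarrow> real.
       r1 \<in> o(\<lambda>m. 1 / real m) \<and>
       r2 \<in> o(\<lambda>n. 1 / real n) \<and>
       r3 \<in> o[sequentially \<times>\<^sub>F sequentially](\<lambda>(m, n). 1 / sqrt (real m * real n)) \<and>
       (\<forall>m\<ge>1. \<forall>n\<ge>1.
          supnorm (\<lambda>x. app m n f x - f x) \<le>
            (2 * supnorm (pd 1 0 f) + 1/2 * supnorm (pd 2 0 f)) / (real m + 2) +
            (2 * supnorm (pd 0 1 f) + 1/2 * supnorm (pd 0 2 f)) / (real n + 2) +
            1/2 * supnorm (pd 1 1 f) / sqrt ((real m + 2) * (real n + 2)) +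
            r1 m + r2 n + r3 (m, n))) \<and>
    (\<exists>r :: nat \<Rightarrow> real. r \<in> o(\<lambda>n. 1 / real n) \<and>
       (\<forall>n\<ge>1. supnorm (\<lambda>x. app n n f x - f x) \<le> C / (real n + 2) + r n))"
proof -
  define bound where "bound m n =
      (2 * supnorm (pd 1 0 f) + 1/2 * supnorm (pd 2 0 f)) / (real m + 2) +
      (2 * supnorm (pd 0 1 f) + 1/2 * supnorm (pd 0 2 f)) / (real n + 2) +
      1/2 * supnorm (pd 1 1 f) / sqrt ((real m + 2) * (real n + 2))" for m n
  have pointwise: "\<bar>app m n f x - f x\<bar> \<le> bound m n" if "x \<in> unit_square" for m n x
    unfolding bound_def by (rule app_error) fact+
  have sup: "supnorm (\<lambda>x. app m n f x - f x) \<le> bound m n" for m n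
    by (rule supnorm_le) (rule pointwise)
  have inf: "filterlim (\<lambda>p. real (fst p) + 2) at_top (sequentially \<times>\<^sub>F sequentially)"
    "filterlim (\<lambda>p. real (snd p) + 2) at_top (sequentially \<times>\<^sub>F sequentially)"
    by (auto intro!: filterlim_tendsto_add_at_top[OF tendsto_const] filterlim_compose[OF filterlim_real_sequentially]
        filterlim_fst filterlim_snd simp: add.commute[of _ "2::real"])
  have "filterlim (\<lambda>p. sqrt ((real (fst p) + 2) * (real (snd p) + 2))) at_top
      (sequentially \<times>\<^sub>F sequentially)"
    by (intro filterlim_compose[OF sqrt_at_top] filterlim_at_top_mult_at_top inf)
  then have lim: "((\<lambda>p. bound (fst p) (snd p)) \<longlongrightarrow> 0 + 0 + 0) (sequentially \<times>\<^sub>F sequentially)"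
    unfolding bound_def
    by (intro tendsto_add tendsto_divide_0[OF tendsto_const] filterlim_at_top_imp_at_infinity inf)
  have unif: "uniform_limit unit_square (\<lambda>(m, n). app m n f) f (sequentially \<times>\<^sub>F sequentially)"
  proof (rule uniform_limitI)
    fix e :: real assume "e > 0"
    with lim have "\<forall>\<^sub>F p in sequentially \<times>\<^sub>F sequentially. bound (fst p) (snd p) < e"
      by (intro order_tendstoD) auto
    then show "\<forall>\<^sub>F p in sequentially \<times>\<^sub>F sequentially.
        \<forall>x\<in>unit_square. dist ((case p of (m, n) \<Rightarrow> app m n f) x) (f x) < e"
      by eventually_elim
        (auto simp: dist_real_def split_beta intro: le_less_trans[OF pointwise])
  qed
  have diag: "bound n n = C / (real n + 2)" for n
  proof -
    have "sqrt ((real n + 2) * (real n + 2)) = real n + 2"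
      by (simp add: real_sqrt_mult)
    then show ?thesis
      unfolding bound_def C_def
      by (simp only: flip: add_divide_distrib)
        (intro arg_cong2[where f = "(/)"], simp_all add: algebra_simps)
  qed
  show ?thesis
  proof (intro conjI exI[of _ "\<lambda>_. 0"] allI impI)
    show "uniform_limit unit_square (\<lambda>(m, n). app m n f) f (sequentially \<times>\<^sub>F sequentially)"
      by (rule unif)
  qed (use sup sup[of n n for n, unfolded diag] in \<open>simp_all add: bound_def\<close>)
qed

end
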